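(* Let $F$ be a field of $\operatorname{char}(F)=2$ and $\operatorname{rank}_2(F)\geq n+1$. Then $I^nF$ is not linked.
   Context: For a field $F$ of characteristic $2$ with $[F:F^2]<\infty$, one has $[F:F^2]=2^r$ for a nonnegative integer $r$; this $r$ is called the $2$-rank of $F$ and is denoted $\operatorname{rank}_2(F)$. For $a_1,\dots,a_n\in F^\times$, the bilinear $n$-fold Pfister form is $\langle\!\langle a_1,\dots,a_n\rangle\!\rangle=\langle 1,a_1\rangle\otimes\dots\otimes\langle 1,a_n\rangle$ (in characteristic $2$), where $\langle c_1,\dots,c_m\rangle$ is the diagonal symmetric bilinear form. $I^nF$ is the $n$-th power of the fundamental ideal $IF$ (the classes of even-dimensional forms) of the Witt ring of nondegenerate symmetric bilinear forms over $F$; it is generated by the bilinear $n$-fold Pfister forms. $I^nF$ is said to be linked if every two anisotropic bilinear $n$-fold Pfister forms $\varphi,\psi$ over $F$ share an $(n-1)$-fold factor, i.e. there are a bilinear $(n-1)$-fold Pfister form $\pi$ and $a,b\in F^\times$ with $\varphi\simeq\langle\!\langle a\rangle\!\rangle\otimes\pi$ and $\psi\simeq\langle\!\langle b\rangle\!\rangle\otimes\pi$.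
   Formalization: The claim is proved for n ≥ 2; for n = 1 it is false, since any two 1-fold Pfister forms share the 0-fold factor ⟨1⟩, and for n = 0 an (n−1)-fold factor is undefined. *)

theory Defs
  imports
    "HOL-Algebra.Algebraic_Closure_Type"
    "Jordan_Normal_Form.Matrix"
begin

section \<open>The 2-rank of a field of characteristic 2\<close>

definition squares :: "'a::field set" where
  "squares = {x^2 | x. True}"

definition finite_over_squares :: "'a::field itself \<Rightarrow> bool" where
  "finite_over_squares TYPE('a) \<longleftrightarrow>
     ring.finite_dimension (ring_of_type_algebra :: 'a ring) squares UNIV"

definition degree_over_squares :: "'a::field itself \<Rightarrow> nat" where
  "degree_over_squares TYPE('a) =
     ring.dim (ring_of_type_algebra :: 'a ring) squares UNIV"

text \<open>Only meaningful in characteristic 2 and when \<^term>\<open>finite_over_squares TYPE('a::field)\<close>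
  holds; in that case the degree is a power of 2.\<close>

definition rank2 :: "'a::field itself \<Rightarrow> nat" where
  "rank2 TYPE('a) = (THE r. degree_over_squares TYPE('a) = 2 ^ r)"


section \<open>Symmetric bilinear forms\<close>

text \<open>A bilinear form on the space of column vectors of length \<open>m\<close> is given by its
  \<open>m \<times> m\<close> Gram matrix with respect to the standard basis.\<close>

definition bilin :: "'a::field mat \<Rightarrow> 'a vec \<Rightarrow> 'a vec \<Rightarrow> 'a" where
  "bilin A x y = x \<bullet> (A *\<^sub>v y)"

definition anisotropic :: "'a::field mat \<Rightarrow> bool" where
  "anisotropic A \<longleftrightarrow>
     (\<forall>x \<in> carrier_vec (dim_row A). x \<noteq> 0\<^sub>v (dim_row A) \<longrightarrow> bilin A x x \<noteq> 0)"

definition linear_iso :: "nat \<Rightarrow> nat \<Rightarrow> ('a::field vec \<Rightarrow> 'a vec) \<Rightarrow> bool" where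
  "linear_iso m k f \<longleftrightarrow>
     bij_betw f (carrier_vec m) (carrier_vec k) \<and>
     (\<forall>x \<in> carrier_vec m. \<forall>y \<in> carrier_vec m. f (x + y) = f x + f y) \<and>
     (\<forall>c. \<forall>x \<in> carrier_vec m. f (c \<cdot>\<^sub>v x) = c \<cdot>\<^sub>v f x)"

definition isometric :: "'a::field mat \<Rightarrow> 'a mat \<Rightarrow> bool" (infix "\<simeq>" 50) where
  "A \<simeq> B \<longleftrightarrow>
     (\<exists>f. linear_iso (dim_row A) (dim_row B) f \<and>
          (\<forall>x \<in> carrier_vec (dim_row A). \<forall>y \<in> carrier_vec (dim_row A).
             bilin B (f x) (f y) = bilin A x y))"

definition diag_form :: "'a::field list \<Rightarrow> 'a mat" where
  "diag_form cs = mat_diag (length cs) (\<lambda>i. cs ! i)"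

text \<open>The Gram matrix of the tensor product in the basis \<open>e\<^sub>i \<otimes> e\<^sub>j\<close>, ordered
  lexicographically, i.e. the Kronecker product.\<close>

definition tensor_form :: "'a::field mat \<Rightarrow> 'a mat \<Rightarrow> 'a mat" (infixr "\<otimes>\<^sub>b" 70) where
  "A \<otimes>\<^sub>b B =
     mat (dim_row A * dim_row B) (dim_col A * dim_col B)
       (\<lambda>(i, j). A $$ (i div dim_row B, j div dim_col B) * B $$ (i mod dim_row B, j mod dim_col B))"


section \<open>Pfister forms and linkage\<close>

text \<open>Characteristic 2 convention: a 1-fold Pfister form is \<open>\<langle>1, a\<rangle>\<close>
  rather than \<open>\<langle>1, -a\<rangle>\<close>. The 0-fold Pfister form is \<open>\<langle>1\<rangle>\<close>.\<close>

fun pfister :: "'a::field list \<Rightarrow> 'a mat" where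
  "pfister [] = diag_form [1]"
| "pfister (a # as) = diag_form [1, a] \<otimes>\<^sub>b pfister as"

definition pfister_forms :: "nat \<Rightarrow> 'a::field mat set" where
  "pfister_forms n = {pfister as | as. length as = n \<and> 0 \<notin> set as}"

text \<open>\<open>I_linked TYPE('a) n\<close> is the property ``\<open>I\<^sup>nF\<close> is linked'', which is by definition a
  condition on \<open>n\<close>-fold Pfister forms only. It is meant for \<open>n \<ge> 1\<close>: at \<open>n = 0\<close> the
  subtraction truncates.\<close>

definition I_linked :: "'a::field itself \<Rightarrow> nat \<Rightarrow> bool" where
  "I_linked TYPE('a) n \<longleftrightarrow>
     (\<forall>\<phi> \<in> pfister_forms n. \<forall>\<psi> \<in> pfister_forms n.
        anisotropic (\<phi> :: 'a mat) \<and> anisotropic \<psi> \<longrightarrow>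
        (\<exists>\<pi> \<in> pfister_forms (n - 1). \<exists>a b.
           a \<noteq> 0 \<and> b \<noteq> 0 \<and>
           \<phi> \<simeq> pfister [a] \<otimes>\<^sub>b \<pi> \<and> \<psi> \<simeq> pfister [b] \<otimes>\<^sub>b \<pi>))"

end

theory Submission
  imports Defs
begin

text \<open>The diagonal form \<open>x \<mapsto> \<phi>(x, x)\<close> of a Pfister form \<open>\<phi> = \<langle>\<langle>a\<^sub>1,\<dots>,a\<^sub>n\<rangle>\<rangle>\<close> is additive and
  takes exactly the values in \<open>F\<^sup>2(a\<^sub>1,\<dots>,a\<^sub>n)\<close>; \<open>\<phi>\<close> is anisotropic iff this field has degree \<open>2\<^sup>n\<close>
  over \<open>F\<^sup>2\<close>. A common \<open>(n-1)\<close>-fold factor of two anisotropic forms therefore yields a common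
  subfield of degree \<open>2\<^sup>n\<^sup>-\<^sup>1\<close> of their value fields. Given 2-independent
  \<open>a, b, c, d\<^sub>1, \<dots>, d\<^sub>n\<^sub>-\<^sub>2\<close> and \<open>K = F\<^sup>2(d\<^sub>1,\<dots>,d\<^sub>n\<^sub>-\<^sub>2)\<close>, the fields \<open>K(a, b)\<close> and \<open>K(a + bc, c)\<close> have
  degree \<open>2\<^sup>n\<close> but meet in \<open>K\<close> only, so \<open>\<langle>\<langle>a, b, d\<rangle>\<rangle>\<close> and \<open>\<langle>\<langle>a + bc, c, d\<rangle>\<rangle>\<close> are not linked.\<close>

section \<open>Isometry invariants: anisotropy and the set of represented values\<close>

section \<open>Isometries\<close>

lemma anisotropic_isometric:
  fixes A B :: "'a::field mat"
  assumes "isometric A B" and "anisotropic A"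
  shows "anisotropic B"
  unfolding anisotropic_def
proof (intro ballI impI)
  fix y :: "'a vec"
  assume y: "y \<in> carrier_vec (dim_row B)" "y \<noteq> 0\<^sub>v (dim_row B)"
  obtain f where f: "linear_iso (dim_row A) (dim_row B) f"
    and b: "\<forall>x \<in> carrier_vec (dim_row A). \<forall>y \<in> carrier_vec (dim_row A).
             bilin B (f x) (f y) = bilin A x y"
    using assms(1) unfolding isometric_def by blast
  obtain x where x: "x \<in> carrier_vec (dim_row A)" "f x = y"
    using f y(1) unfolding linear_iso_def bij_betw_def by (metis imageE)
  have fx: "f (0 \<cdot>\<^sub>v x) = 0 \<cdot>\<^sub>v f x"
    using f x(1) unfolding linear_iso_def by blast
  have "x \<noteq> 0\<^sub>v (dim_row A)"
  proof
    assume "x = 0\<^sub>v (dim_row A)"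
    hence "0 \<cdot>\<^sub>v x = x" by (simp add: smult_vec_def zero_vec_def vec_eq_iff)
    hence "y = 0 \<cdot>\<^sub>v y" using fx x(2) by simp
    moreover have "0 \<cdot>\<^sub>v y = 0\<^sub>v (dim_row B)" using y(1) by auto
    ultimately show False using y(2) by simp
  qed
  thus "bilin B y y \<noteq> 0"
    using assms(2) b x unfolding anisotropic_def by metis
qed

text \<open>The invariant that links forms to fields: for a Pfister form it turns out to be a
  subfield of F containing all squares.\<close>

definition form_values :: "'a::field mat \<Rightarrow> 'a set" where
  "form_values A = {bilin A x x | x. x \<in> carrier_vec (dim_row A)}"

lemma form_values_isometric:
  assumes "isometric A B"
  shows "form_values A = form_values B"
proof -
  obtain f where f: "f ` carrier_vec (dim_row A) = carrier_vec (dim_row B)"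
    and b: "\<forall>x \<in> carrier_vec (dim_row A). \<forall>y \<in> carrier_vec (dim_row A).
             bilin B (f x) (f y) = bilin A x y"
    using assms unfolding isometric_def linear_iso_def bij_betw_def by blast
  have "form_values B = (\<lambda>y. bilin B y y) ` f ` carrier_vec (dim_row A)"
    unfolding form_values_def f by blast
  also have "\<dots> = form_values A"
    unfolding form_values_def image_image using b by (auto intro!: image_eqI)
  finally show ?thesis by simp
qed

section \<open>Diagonal forms\<close>

text \<open>Coordinates are a function on all naturals rather than a vector, so that restricting to
  a later block of entries is an index shift. Values of \<open>x\<close> from
  \<open>length cs\<close> on do not matter.\<close>

definition diag_value :: "'a::field list \<Rightarrow> (nat \<Rightarrow> 'a) \<Rightarrow> 'a" where
  "diag_value cs x = (\<Sum>i<length cs. cs ! i * (x i)\<^sup>2)"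

lemma diag_value_cong:
  "(\<And>i. i < length cs \<Longrightarrow> x i = y i) \<Longrightarrow> diag_value cs x = diag_value cs y"
  unfolding diag_value_def by (rule sum.cong) auto

lemma diag_value_append:
  "diag_value (cs @ ds) x = diag_value cs x + diag_value ds (\<lambda>i. x (length cs + i))"
proof -
  have sum_split: "(\<Sum>i<m + n. f i) = (\<Sum>i<m. f i) + (\<Sum>i<n. f (m + i))"
    for m n and f :: "nat \<Rightarrow> 'a"
    by (induction n) (simp_all add: add.assoc)
  have "diag_value (cs @ ds) x = (\<Sum>i<length cs + length ds. (cs @ ds) ! i * (x i)\<^sup>2)"
    unfolding diag_value_def by simp
  also have "\<dots> = (\<Sum>i<length cs. (cs @ ds) ! i * (x i)\<^sup>2)
      + (\<Sum>i<length ds. (cs @ ds) ! (length cs + i) * (x (length cs + i))\<^sup>2)"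
    by (rule sum_split)
  also have "\<dots> = diag_value cs x + diag_value ds (\<lambda>i. x (length cs + i))"
    unfolding diag_value_def by (simp add: nth_append)
  finally show ?thesis .
qed

lemma diag_value_map_mult:
  "diag_value (map ((*) a) cs) x = a * diag_value cs x"
  unfolding diag_value_def by (simp add: sum_distrib_left mult.assoc)

lemma diag_form_dim [simp]:
  "dim_row (diag_form cs) = length cs" "dim_col (diag_form cs) = length cs"
  by (simp_all add: diag_form_def mat_diag_def)

lemma bilin_diag_form:
  assumes "x \<in> carrier_vec (length cs)"
  shows "bilin (diag_form cs) x x = diag_value cs (($) x)"
proof -
  have "(diag_form cs *\<^sub>v x) $ i = cs ! i * x $ i" if "i < length cs" for i
  proof -
    have "(diag_form cs *\<^sub>v x) $ i = (\<Sum>j<length cs. (if i = j then cs ! j else 0) * x $ j)"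
      using that assms
      by (auto simp: diag_form_def mat_diag_def scalar_prod_def lessThan_atLeast0 intro!: sum.cong)
    also have "\<dots> = (\<Sum>j<length cs. if i = j then cs ! j * x $ j else 0)"
      by (rule sum.cong) auto
    finally show ?thesis using that by simp
  qed
  thus ?thesis
    unfolding bilin_def diag_value_def scalar_prod_def
    by (auto simp: lessThan_atLeast0 power2_eq_square mult.left_commute intro!: sum.cong)
qed

lemma form_values_diag_form:
  "form_values (diag_form cs) = range (diag_value cs)"
proof
  show "form_values (diag_form cs) \<subseteq> range (diag_value cs)"
    by (auto simp: form_values_def bilin_diag_form)
  show "range (diag_value cs) \<subseteq> form_values (diag_form cs)"
  proof clarify
    fix x :: "nat \<Rightarrow> 'a"
    have "diag_value cs x = bilin (diag_form cs) (vec (length cs) x) (vec (length cs) x)"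
      by (simp add: bilin_diag_form cong: diag_value_cong)
    thus "diag_value cs x \<in> form_values (diag_form cs)"
      unfolding form_values_def by (auto intro!: exI[of _ "vec (length cs) x"])
  qed
qed

lemma anisotropic_diag_form:
  "anisotropic (diag_form cs) \<longleftrightarrow> (\<forall>x. diag_value cs x = 0 \<longrightarrow> (\<forall>i<length cs. x i = 0))"
proof
  assume an: "anisotropic (diag_form cs)"
  show "\<forall>x. diag_value cs x = 0 \<longrightarrow> (\<forall>i<length cs. x i = 0)"
  proof (intro allI impI)
    fix x :: "nat \<Rightarrow> 'a" and i
    assume x: "diag_value cs x = 0" and i: "i < length cs"
    have "diag_value cs x = bilin (diag_form cs) (vec (length cs) x) (vec (length cs) x)"
      by (simp add: bilin_diag_form cong: diag_value_cong)
    hence "vec (length cs) x = 0\<^sub>v (length cs)"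
      using an x unfolding anisotropic_def by (metis diag_form_dim(1) vec_carrier)
    thus "x i = 0" using i by (metis index_vec index_zero_vec(1))
  qed
next
  assume *: "\<forall>x. diag_value cs x = 0 \<longrightarrow> (\<forall>i<length cs. x i = 0)"
  show "anisotropic (diag_form cs)"
    unfolding anisotropic_def
  proof (intro ballI impI notI)
    fix x :: "'a vec"
    assume x: "x \<in> carrier_vec (dim_row (diag_form cs))" "x \<noteq> 0\<^sub>v (dim_row (diag_form cs))"
      "bilin (diag_form cs) x x = 0"
    hence "\<forall>i<length cs. x $ i = 0" using * bilin_diag_form[of x cs] by simp
    hence "x = 0\<^sub>v (length cs)" using x(1) by (intro eq_vecI) auto
    thus False using x(2) by simp
  qed
qed

section \<open>Pfister forms as diagonal forms\<close>

fun pfister_entries :: "'a::field list \<Rightarrow> 'a list" where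
  "pfister_entries [] = [1]"
| "pfister_entries (a # as) = pfister_entries as @ map ((*) a) (pfister_entries as)"

lemma length_pfister_entries [simp]: "length (pfister_entries as) = 2 ^ length as"
  by (induction as) simp_all

lemma pfister_entries_nth_0: "pfister_entries as ! 0 = 1"
  by (induction as) (simp_all add: nth_append)

lemma tensor_diag_form_two:
  assumes "cs \<noteq> []"
  shows "diag_form [1, a] \<otimes>\<^sub>b diag_form cs = diag_form (cs @ map ((*) a) cs)"
proof (rule eq_matI)
  fix i j
  define m where "m = length cs"
  assume "i < dim_row (diag_form (cs @ map ((*) a) cs))"
    and "j < dim_col (diag_form (cs @ map ((*) a) cs))"
  hence ij: "i < 2 * m" "j < 2 * m" by (simp_all add: m_def)
  have m: "m > 0" using assms by (simp add: m_def)
  \<comment> \<open>Below \<open>2 * m\<close>, the quotient by \<open>m\<close> names one of the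
    two diagonal blocks and the remainder is the position inside it.\<close>
  have dm: "k div m = (if k < m then 0 else 1) \<and> k mod m = (if k < m then k else k - m)"
    if "k < 2 * m" for k
  proof (cases "k < m")
    case False
    then obtain l where "k = m + l" using le_Suc_ex not_less by blast
    thus ?thesis using m that by simp
  qed simp
  show "(diag_form [1, a] \<otimes>\<^sub>b diag_form cs) $$ (i, j) = diag_form (cs @ map ((*) a) cs) $$ (i, j)"
    using ij m dm[OF ij(1)] dm[OF ij(2)]
    by (cases "i < m"; cases "j < m")
       (auto simp: tensor_form_def diag_form_def mat_diag_def m_def[symmetric] nth_append)
qed (simp_all add: tensor_form_def)

lemma pfister_eq_diag_form: "pfister as = diag_form (pfister_entries as)"
proof (induction as)
  case (Cons a as)
  have "pfister_entries as \<noteq> []"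
    using length_pfister_entries[of as] by (metis list.size(3) power_eq_0_iff zero_neq_numeral)
  thus ?case using Cons by (simp add: tensor_diag_form_two)
qed simp

text \<open>Bridges the shape used in \<open>I_linked\<close> and the recursion:
  \<open>pfister [a]\<close> is by definition \<open>diag_form [1, a]\<close> tensored with the form
  of the single entry 1, so the two are equal only after evaluation.\<close>

lemma pfister_single_tensor: "pfister [a] \<otimes>\<^sub>b pfister as = pfister (a # as)"
  using pfister_eq_diag_form[of "[a]"] by simp

section \<open>The fields generated over the squares\<close>

text \<open>In characteristic 2 this is the field F^2(a_1, ..., a_n): every generator has its square
  in F^2, so polynomials of degree at most 1 in each generator suffice.\<close>

fun sq_adjoin :: "'a::field list \<Rightarrow> 'a set" where
  "sq_adjoin [] = squares"
| "sq_adjoin (a # as) = {x + a * y | x y. x \<in> sq_adjoin as \<and> y \<in> sq_adjoin as}"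

text \<open>Each generator is tested against the field of the later ones only, so each adjunction is
  a proper quadratic extension.\<close>

fun two_independent :: "'a::field list \<Rightarrow> bool" where
  "two_independent [] \<longleftrightarrow> True"
| "two_independent (a # as) \<longleftrightarrow> a \<notin> sq_adjoin as \<and> two_independent as"

lemma two_independent_drop: "two_independent as \<Longrightarrow> two_independent (drop k as)"
proof (induction k arbitrary: as)
  case (Suc k)
  thus ?case by (cases as) simp_all
qed simp

lemma square_mem_squares: "x\<^sup>2 \<in> squares"
  by (auto simp: squares_def)

lemma zero_mem_squares: "0 \<in> squares"
  using square_mem_squares[of 0] by simp

lemma sq_adjoin_ConsI:
  "x \<in> sq_adjoin as \<Longrightarrow> y \<in> sq_adjoin as \<Longrightarrow> x + a * y \<in> sq_adjoin (a # as)"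
  by auto

lemma sq_adjoin_zero: "0 \<in> sq_adjoin as"
  by (induction as) (use zero_mem_squares in force)+

lemma sq_adjoin_Cons_subset: "sq_adjoin as \<subseteq> sq_adjoin (a # as)"
  using sq_adjoin_zero[of as] by force

lemma squares_subset_sq_adjoin: "squares \<subseteq> sq_adjoin as"
  by (induction as) (use sq_adjoin_Cons_subset in force)+

lemma sq_adjoin_square: "x\<^sup>2 \<in> sq_adjoin as"
  using square_mem_squares squares_subset_sq_adjoin by blast

lemma sq_adjoin_one: "1 \<in> sq_adjoin as"
  using sq_adjoin_square[of 1] by simp

lemma sq_adjoin_generator: "a \<in> sq_adjoin (a # as)"
  using sq_adjoin_ConsI[OF sq_adjoin_zero sq_adjoin_one, of a as] by simp

section \<open>Characteristic 2: the sets \<open>sq_adjoin as\<close> are fields\<close>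

context
  fixes ty :: "'a::field itself"
  assumes char2: "CHAR('a) = 2"
begin

lemma char2_add_self: "x + x = (0 :: 'a)"
proof -
  have "(2 :: 'a) = 0"
    using of_nat_CHAR[where 'a = 'a] char2 by simp
  thus ?thesis by (metis mult_2 mult_zero_left)
qed

lemma char2_uminus: "- x = (x :: 'a)"
  using char2_add_self[of x] by (simp add: eq_neg_iff_add_eq_0 minus_equation_iff)

lemma char2_add_eq_0_iff: "x + y = 0 \<longleftrightarrow> x = (y :: 'a)"
  using char2_uminus by (metis eq_neg_iff_add_eq_0)

lemma sq_adjoin_add:
  "x \<in> sq_adjoin as \<Longrightarrow> y \<in> sq_adjoin as \<Longrightarrow> x + y \<in> sq_adjoin (as :: 'a list)"
proof (induction as arbitrary: x y)
  case Nil
  then obtain u v where "x = u\<^sup>2" "y = v\<^sup>2" by (auto simp: squares_def)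
  moreover have "u\<^sup>2 + v\<^sup>2 = (u + v)\<^sup>2"
    using char2_add_self[of "u * v"] by (simp add: power2_eq_square algebra_simps)
  ultimately show ?case using square_mem_squares by simp
next
  case (Cons a as)
  then obtain p q r s where *: "x = p + a * q" "y = r + a * s"
    "p \<in> sq_adjoin as" "q \<in> sq_adjoin as" "r \<in> sq_adjoin as" "s \<in> sq_adjoin as" by auto
  have "x + y = (p + r) + a * (q + s)" by (simp add: * algebra_simps)
  also have "\<dots> \<in> sq_adjoin (a # as)" using * Cons.IH by (intro sq_adjoin_ConsI)
  finally show ?case .
qed

lemma sq_adjoin_mult:
  "x \<in> sq_adjoin as \<Longrightarrow> y \<in> sq_adjoin as \<Longrightarrow> x * y \<in> sq_adjoin (as :: 'a list)"
proof (induction as arbitrary: x y)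
  case Nil
  thus ?case using square_mem_squares by (auto simp: squares_def simp flip: power_mult_distrib)
next
  case (Cons a as)
  then obtain p q r s where *: "x = p + a * q" "y = r + a * s"
    "p \<in> sq_adjoin as" "q \<in> sq_adjoin as" "r \<in> sq_adjoin as" "s \<in> sq_adjoin as" by auto
  \<comment> \<open>The term with \<open>a\<^sup>2\<close> moves into the constant part, since
    \<open>a\<^sup>2\<close> is a square and so lies in the smaller field.\<close>
  have "x * y = (p * r + a\<^sup>2 * (q * s)) + a * (p * s + q * r)"
    by (simp add: * algebra_simps power2_eq_square)
  also have "\<dots> \<in> sq_adjoin (a # as)"
    using * by (intro sq_adjoin_ConsI sq_adjoin_add Cons.IH[OF sq_adjoin_square] Cons.IH)
  finally show ?case .
qed

text \<open>The inverse of \<open>x\<close> is \<open>x\<close> times a square, so closure under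
  products is enough.\<close>

lemma sq_adjoin_inverse:
  assumes "x \<in> sq_adjoin (as :: 'a list)"
  shows "inverse x \<in> sq_adjoin as"
proof -
  have "inverse x = x * (inverse x)\<^sup>2" by (cases "x = 0") (simp_all add: power2_eq_square)
  thus ?thesis using assms sq_adjoin_mult sq_adjoin_square by metis
qed

lemma sq_adjoin_divide:
  "x \<in> sq_adjoin as \<Longrightarrow> y \<in> sq_adjoin as \<Longrightarrow> x / y \<in> sq_adjoin (as :: 'a list)"
  unfolding divide_inverse by (intro sq_adjoin_mult sq_adjoin_inverse)

text \<open>A nonzero \<open>y\<close> would give \<open>a = x / y\<close> in the field. This
  comparison of coefficients of 1 and \<open>a\<close> drives all later independence
  arguments.\<close>

lemma sq_adjoin_linear_independent:
  assumes "a \<notin> sq_adjoin (as :: 'a list)" and "x \<in> sq_adjoin as" and "y \<in> sq_adjoin as"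
    and "x + a * y = 0"
  shows "x = 0 \<and> y = 0"
proof -
  have "y = 0"
  proof (rule ccontr)
    assume "y \<noteq> 0"
    moreover have "x = a * y" using assms(4) char2_add_eq_0_iff by blast
    ultimately have "a = x / y" by simp
    thus False using assms sq_adjoin_divide by blast
  qed
  thus ?thesis using assms(4) by simp
qed

subsection \<open>Values and anisotropy of Pfister forms\<close>

text \<open>Both sides obey the same recursion: the two halves of the coordinates contribute
  \<open>u\<close> and \<open>a * v\<close> with independent \<open>u\<close> and
  \<open>v\<close>.\<close>

lemma range_diag_value_pfister_entries:
  "range (diag_value (pfister_entries as)) = sq_adjoin (as :: 'a list)"
proof (induction as)
  case Nil
  show ?case
  proof
    show "sq_adjoin [] \<subseteq> range (diag_value (pfister_entries [] :: 'a list))"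
    proof
      fix z :: 'a assume "z \<in> sq_adjoin []"
      then obtain x where "z = x\<^sup>2" by (auto simp: squares_def)
      hence "z = diag_value (pfister_entries []) (\<lambda>_. x)" by (simp add: diag_value_def)
      thus "z \<in> range (diag_value (pfister_entries []))" by blast
    qed
  qed (auto simp: diag_value_def squares_def)
next
  case (Cons a as)
  let ?d = "diag_value (pfister_entries as)"
  have eq: "diag_value (pfister_entries (a # as)) x = ?d x + a * ?d (\<lambda>i. x (2 ^ length as + i))" for x
    by (simp add: diag_value_append diag_value_map_mult)
  show ?case
  proof
    show "range (diag_value (pfister_entries (a # as))) \<subseteq> sq_adjoin (a # as)"
      using Cons.IH unfolding image_subset_iff eq by (blast intro: sq_adjoin_ConsI)
    show "sq_adjoin (a # as) \<subseteq> range (diag_value (pfister_entries (a # as)))"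
    proof
      fix z assume "z \<in> sq_adjoin (a # as)"
      then obtain u v where z: "z = u + a * v" "u \<in> range ?d" "v \<in> range ?d"
        using Cons.IH by auto
      then obtain x y where xy: "u = ?d x" "v = ?d y" by blast
      define w where "w = (\<lambda>i. if i < 2 ^ length as then x i else y (i - 2 ^ length as))"
      have "?d w = ?d x" by (rule diag_value_cong) (simp add: w_def)
      moreover have "(\<lambda>i. w (2 ^ length as + i)) = y" by (simp add: w_def)
      ultimately have "diag_value (pfister_entries (a # as)) w = z" using eq z xy by simp
      thus "z \<in> range (diag_value (pfister_entries (a # as)))" by blast
    qed
  qed
qed

lemma form_values_pfister: "form_values (pfister as) = sq_adjoin (as :: 'a list)"
  by (simp add: pfister_eq_diag_form form_values_diag_form range_diag_value_pfister_entries)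

text \<open>A zero of the form for \<open>a # as\<close> is a relation u + a v = 0 between two
  values of the form for \<open>as\<close>. If \<open>a\<close> is outside the field, both values
  vanish and induction applies; otherwise such a relation with v = 1 exists.\<close>

lemma anisotropic_pfister_iff: "anisotropic (pfister as) \<longleftrightarrow> two_independent (as :: 'a list)"
  unfolding pfister_eq_diag_form anisotropic_diag_form
proof (induction as)
  case (Cons a as)
  let ?d = "diag_value (pfister_entries as)" and ?N = "2 ^ length as :: nat"
  have eq: "diag_value (pfister_entries (a # as)) x = ?d x + a * ?d (\<lambda>i. x (?N + i))" for x
    by (simp add: diag_value_append diag_value_map_mult)
  have mem: "?d x \<in> sq_adjoin as" for x
    using range_diag_value_pfister_entries by blast
  show ?case
  proof
    assume an: "\<forall>x. diag_value (pfister_entries (a # as)) x = 0 \<longrightarrow>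
      (\<forall>i<length (pfister_entries (a # as)). x i = 0)"
    have "x i = 0" if "?d x = 0" "i < ?N" for x i
    proof -
      \<comment> \<open>Padding with zeros turns a zero of the smaller form into one of the
        larger.\<close>
      define w where "w = (\<lambda>i. if i < ?N then x i else 0)"
      have "?d w = ?d x" by (rule diag_value_cong) (simp add: w_def)
      moreover have "?d (\<lambda>i. w (?N + i)) = 0" by (simp add: w_def diag_value_def)
      ultimately have "w i = 0" using an eq[of w] that by simp
      thus ?thesis using that by (simp add: w_def)
    qed
    hence "two_independent as" using Cons.IH by simp
    moreover have "a \<notin> sq_adjoin as"
    proof
      assume "a \<in> sq_adjoin as"
      then obtain x where x: "a = ?d x" using range_diag_value_pfister_entries by blast
      \<comment> \<open>The second block is the first unit vector, whose value is 1 because the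
        first Pfister entry is 1. The total is then a + a = 0 although \<open>w\<close> is not
        zero.\<close>
      define w where "w = (\<lambda>i. if i < ?N then x i else if i = ?N then 1 else 0)"
      have "?d w = ?d x" by (rule diag_value_cong) (simp add: w_def)
      moreover have "?d (\<lambda>i. w (?N + i)) = 1"
      proof -
        have "?d (\<lambda>i. w (?N + i)) = (\<Sum>i<?N. if i = 0 then 1 else 0)"
          unfolding diag_value_def length_pfister_entries
          by (rule sum.cong) (auto simp: w_def pfister_entries_nth_0[simplified])
        thus ?thesis by simp
      qed
      ultimately have "diag_value (pfister_entries (a # as)) w = 0"
        using eq[of w] x char2_add_self by simp
      hence "w ?N = 0" using an by simp
      thus False by (simp add: w_def)
    qed
    ultimately show "two_independent (a # as)" by simp
  next
    assume ind: "two_independent (a # as)"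
    show "\<forall>x. diag_value (pfister_entries (a # as)) x = 0 \<longrightarrow>
      (\<forall>i<length (pfister_entries (a # as)). x i = 0)"
    proof (intro allI impI)
      fix x i
      assume x: "diag_value (pfister_entries (a # as)) x = 0"
        and i: "i < length (pfister_entries (a # as))"
      have 0: "?d x = 0 \<and> ?d (\<lambda>i. x (?N + i)) = 0"
        using sq_adjoin_linear_independent[of a as] ind mem x eq by auto
      show "x i = 0"
      proof (cases "i < ?N")
        case True
        thus ?thesis using 0 Cons.IH ind by simp
      next
        case False
        then obtain j where "i = ?N + j" "j < ?N"
          using i by (metis add_less_cancel_left le_Suc_ex length_pfister_entries length_Cons
              mult_2 not_less power_Suc)
        moreover have "\<forall>i<?N. x (?N + i) = 0"
          using conjunct2[OF 0] Cons.IH[THEN iffD2, rule_format, of "\<lambda>i. x (?N + i)"] ind by simp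
        ultimately show ?thesis by simp
      qed
    qed
  qed
qed (simp add: diag_value_def)

section \<open>Degrees by the tower law, and maximal 2-independent lists\<close>

subsection \<open>Degree over the squares\<close>

interpretation type_ring: field "ring_of_type_algebra :: 'a ring"
  by (rule field_from_type_algebra)

abbreviation dimension_over :: "nat \<Rightarrow> 'a set \<Rightarrow> 'a set \<Rightarrow> bool" where
  "dimension_over \<equiv> ring.dimension (ring_of_type_algebra :: 'a ring)"

lemma subfield_sq_adjoin: "subfield (sq_adjoin (as :: 'a list)) ring_of_type_algebra"
proof (rule type_ring.subfieldI')
  show "subring (sq_adjoin as) ring_of_type_algebra"
  proof (rule type_ring.subringI)
    fix h assume "h \<in> sq_adjoin as"
    moreover have "\<ominus>\<^bsub>ring_of_type_algebra\<^esub> h = h"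
      by (rule type_ring.minus_equality)
         (simp_all add: ring_of_type_algebra_def char2_add_self)
    ultimately show "\<ominus>\<^bsub>ring_of_type_algebra\<^esub> h \<in> sq_adjoin as" by simp
  qed (simp_all add: ring_of_type_algebra_def sq_adjoin_one sq_adjoin_add sq_adjoin_mult)
  fix k assume k: "k \<in> sq_adjoin as - {\<zero>\<^bsub>ring_of_type_algebra\<^esub>}"
  hence "inv\<^bsub>ring_of_type_algebra\<^esub> k = inverse k"
    by (intro type_ring.comm_inv_char) (simp_all add: ring_of_type_algebra_def)
  thus "inv\<^bsub>ring_of_type_algebra\<^esub> k \<in> sq_adjoin as"
    using k sq_adjoin_inverse by simp
qed

lemma subfield_squares: "subfield (squares :: 'a set) ring_of_type_algebra"
  using subfield_sq_adjoin[of "[]"] by simp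

lemma line_extension_eq:
  "type_ring.line_extension K a E = {k * a + v | k v. k \<in> K \<and> v \<in> E}"
proof -
  have "u \<in> type_ring.line_extension K a E \<longleftrightarrow> (\<exists>k\<in>K. \<exists>v\<in>E. u = k * a + v)" for u
    unfolding type_ring.line_extension_mem_iff by (simp add: ring_of_type_algebra_def)
  thus ?thesis by blast
qed

text \<open>Tower law: over K = \<open>sq_adjoin as\<close> the next field is K + K a, of dimension
  2 because \<open>a\<close> is not in K.\<close>

lemma dimension_sq_adjoin:
  "two_independent (as :: 'a list) \<Longrightarrow> dimension_over (2 ^ length as) squares (sq_adjoin as)"
proof (induction as)
  case Nil
  thus ?case using type_ring.dimension_one[OF subfield_squares] by simp
next
  case (Cons a as)
  let ?K = "sq_adjoin as"
  have "dimension_over (Suc 1) ?K (type_ring.line_extension ?K a ?K)"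
    using type_ring.dimension_one[OF subfield_sq_adjoin] Cons.prems
    by (intro type_ring.Suc_dim) (simp_all add: ring_of_type_algebra_def)
  moreover have "type_ring.line_extension ?K a ?K = sq_adjoin (a # as)"
    unfolding line_extension_eq by (auto, (metis add.commute mult.commute)+)
  ultimately have "dimension_over (2 ^ length as * 2) squares (sq_adjoin (a # as))"
    using type_ring.telescopic_base[OF subfield_squares subfield_sq_adjoin, of "2 ^ length as" as 2]
      Cons by (simp add: numeral_2_eq_2)
  thus ?case by (simp add: mult.commute)
qed

text \<open>A basis of \<open>E\<close> over the squares stays independent inside
  \<open>E'\<close>.\<close>

lemma dimension_mono:
  assumes "dimension_over m squares (E :: 'a set)" and "dimension_over k squares E'" and "E \<subseteq> E'"
  shows "m \<le> k"
proof -
  obtain Us where "type_ring.independent squares Us" "length Us = m"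
    "type_ring.Span squares Us = E" "set Us \<subseteq> carrier ring_of_type_algebra"
    using type_ring.exists_base[OF subfield_squares assms(1)] by blast
  thus ?thesis
    using type_ring.independent_length_le_dimension[OF subfield_squares assms(2)]
      type_ring.Span_base_incl[OF subfield_squares] assms(3) by blast
qed

lemma two_independent_length_le:
  assumes "two_independent (as :: 'a list)" and "two_independent bs" and "sq_adjoin as \<subseteq> sq_adjoin bs"
  shows "length as \<le> length bs"
proof -
  have "(2 :: nat) ^ length as \<le> 2 ^ length bs"
    using dimension_mono dimension_sq_adjoin assms by blast
  thus ?thesis by simp
qed

text \<open>A 2-independent list of maximal length generates all of F, since any element outside its
  field could be prepended. Its length is therefore the exponent of the degree, which also shows
  that the description defining \<open>rank2\<close> has a value.\<close>

lemma exists_two_basis: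
  assumes "finite_over_squares TYPE('a)"
  obtains as :: "'a list" where "two_independent as" and "length as = rank2 TYPE('a)"
proof -
  obtain N where N: "dimension_over N squares (UNIV :: 'a set)"
    using assms type_ring.finite_dimensionE[OF subfield_squares]
    unfolding finite_over_squares_def by blast
  define P where "P = (\<lambda>r. \<exists>as :: 'a list. two_independent as \<and> length as = r)"
  have bound: "r < N" if r: "P r" for r
  proof -
    obtain as :: "'a list" where as: "two_independent as" "length as = r"
      using r unfolding P_def by blast
    \<comment> \<open>Finite degree bounds the length of 2-independent lists, so a longest one
      exists.\<close>
    have "2 ^ r \<le> N"
      using dimension_mono[OF dimension_sq_adjoin[OF as(1)] N] as(2) by simp
    thus ?thesis using less_exp[of r] by linarith
  qed
  have "P 0" by (simp add: P_def)
  then obtain r where r: "P r" "\<And>k. P k \<Longrightarrow> k \<le> r"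
    using bound ex_has_greatest_nat[of P 0 id N] less_imp_le by auto
  then obtain as :: "'a list" where as: "two_independent as" "length as = r"
    unfolding P_def by blast
  have "sq_adjoin as = UNIV"
  proof (rule ccontr)
    assume "sq_adjoin as \<noteq> UNIV"
    then obtain a where "a \<notin> sq_adjoin as" by blast
    hence "P (Suc r)" using as unfolding P_def by (intro exI[of _ "a # as"]) simp
    thus False using r(2) by fastforce
  qed
  hence "degree_over_squares TYPE('a) = 2 ^ r"
    using type_ring.dimI[OF subfield_squares] dimension_sq_adjoin[OF as(1)] as(2)
    unfolding degree_over_squares_def by (metis over_def)
  hence "rank2 TYPE('a) = r"
    unfolding rank2_def by (intro the_equality) simp_all
  thus ?thesis using that as by blast
qed

section \<open>Two fields with small intersection, and the common subfield forced by linkage\<close>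

subsection \<open>Linkage\<close>

text \<open>With K = \<open>sq_adjoin ds\<close> and L = K(a, b), an element of the second field is
  expanded in powers of \<open>c\<close>, where \<open>c\<^sup>2\<close> is a scalar from F^2.
  Membership in L kills the coefficient of \<open>c\<close>, and independence of 1, a, b over K then
  removes everything except the constant \<open>p\<close>.\<close>

lemma sq_adjoin_inter:
  assumes "two_independent (c # a # b # ds :: 'a list)"
  shows "sq_adjoin (a # b # ds) \<inter> sq_adjoin ((a + b * c) # c # ds) \<subseteq> sq_adjoin ds"
proof
  fix z assume z: "z \<in> sq_adjoin (a # b # ds) \<inter> sq_adjoin ((a + b * c) # c # ds)"
  let ?K = "sq_adjoin ds" and ?L = "sq_adjoin (a # b # ds)"
  obtain p q p' q' where K: "p \<in> ?K" "q \<in> ?K" "p' \<in> ?K" "q' \<in> ?K"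
    and zeq: "z = (p + c * p') + (a + b * c) * (q + c * q')"
    using z by auto
  have incl: "?K \<subseteq> sq_adjoin (b # ds)" "sq_adjoin (b # ds) \<subseteq> ?L"
    using sq_adjoin_Cons_subset by blast+
  hence ab: "a \<in> ?L" "b \<in> ?L" using sq_adjoin_generator by blast+
  \<comment> \<open>\<open>?v\<close> is the coefficient of \<open>c\<close> in \<open>z\<close>,
    and \<open>?u\<close> is the sum of \<open>z\<close> and its part free of \<open>c\<close>; in
    characteristic 2 this sum is also the difference.\<close>
  let ?u = "z + (p + a * q + b * c\<^sup>2 * q')" and ?v = "(p' + b * q) + a * q'"
  have "?u + c * ?v = z + z"
    unfolding zeq by (simp add: algebra_simps power2_eq_square)
  hence "?u + c * ?v = 0" by (simp add: char2_add_self)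
  moreover have "?u \<in> ?L"
    using z K incl ab sq_adjoin_square by (intro sq_adjoin_add sq_adjoin_mult) auto
  moreover have "?v \<in> ?L"
    using K incl ab by (intro sq_adjoin_add sq_adjoin_mult) auto
  moreover have "c \<notin> ?L" using assms by simp
  ultimately have u: "?u = 0" and v: "?v = 0"
    using sq_adjoin_linear_independent by blast+
  have "p' + b * q \<in> sq_adjoin (b # ds)" using K by auto
  hence "p' + b * q = 0" and q': "q' = 0"
    using sq_adjoin_linear_independent[of a "b # ds" "p' + b * q" q'] v K incl assms by auto
  hence "q = 0"
    using sq_adjoin_linear_independent[of b ds p' q] K assms by auto
  hence "z = p" using u q' char2_add_eq_0_iff by simp
  thus "z \<in> ?K" using K by simp
qed

text \<open>If a + b c = u + c v with u, v in K, comparing coefficients of \<open>c\<close> over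
  K(a, b) gives b = v, contradicting that \<open>b\<close> is not in K.\<close>

lemma two_independent_transform:
  assumes "two_independent (c # a # b # ds :: 'a list)"
  shows "two_independent ((a + b * c) # c # ds)"
proof -
  let ?K = "sq_adjoin ds" and ?L = "sq_adjoin (a # b # ds)"
  have ind: "c \<notin> ?L" "a \<notin> sq_adjoin (b # ds)" "b \<notin> ?K" "two_independent ds"
    using assms by simp_all
  have incl: "?K \<subseteq> sq_adjoin (b # ds)" "sq_adjoin (b # ds) \<subseteq> ?L"
    using sq_adjoin_Cons_subset by blast+
  hence ab: "a \<in> ?L" "b \<in> ?L" using sq_adjoin_generator by blast+
  have "a + b * c \<notin> sq_adjoin (c # ds)"
  proof
    assume "a + b * c \<in> sq_adjoin (c # ds)"
    then obtain u v where uv: "u \<in> ?K" "v \<in> ?K" "a + b * c = u + c * v" by auto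
    have "(a + u) + c * (b + v) = (a + b * c) + (u + c * v)" by (simp add: algebra_simps)
    also have "\<dots> = 0" unfolding uv(3) by (rule char2_add_self)
    finally have "b + v = 0"
      using sq_adjoin_linear_independent[OF ind(1), of "a + u" "b + v"] uv incl ab
      by (meson sq_adjoin_add subsetD)
    hence "b = v" by (simp add: char2_add_eq_0_iff)
    thus False using uv(2) ind(3) by simp
  qed
  moreover have "c \<notin> ?K" using ind(1) incl by blast
  ultimately show ?thesis using ind(4) by simp
qed

lemma two_independent_nonzero: "two_independent (as :: 'a list) \<Longrightarrow> 0 \<notin> set as"
  using sq_adjoin_zero by (induction as) auto

text \<open>The common factor is \<open>pfister cs\<close>. Isometry carries anisotropy to
  \<open>pfister (a # cs)\<close>, which makes \<open>cs\<close> 2-independent, and equates the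
  value fields with those of \<open>a # cs\<close> and \<open>b # cs\<close>, both of which contain
  \<open>sq_adjoin cs\<close>.\<close>

lemma linked_common_subfield:
  assumes "I_linked TYPE('a) n" and "n \<ge> 1"
    and "two_independent (as :: 'a list)" and "two_independent bs" and "length as = n" and "length bs = n"
  obtains cs where "two_independent cs" and "length cs = n - 1"
    and "sq_adjoin cs \<subseteq> sq_adjoin as \<inter> sq_adjoin bs"
proof -
  have "pfister as \<in> pfister_forms n" "pfister bs \<in> pfister_forms n"
    using assms two_independent_nonzero unfolding pfister_forms_def by blast+
  moreover have "anisotropic (pfister as)" "anisotropic (pfister bs)"
    using assms anisotropic_pfister_iff by blast+
  ultimately obtain \<pi> a b where "\<pi> \<in> pfister_forms (n - 1)"
    and "isometric (pfister as) (pfister [a] \<otimes>\<^sub>b \<pi>)"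
    and "isometric (pfister bs) (pfister [b] \<otimes>\<^sub>b \<pi>)"
    using assms(1) unfolding I_linked_def by blast
  then obtain cs where cs: "length cs = n - 1"
    and iso: "isometric (pfister as) (pfister (a # cs))" "isometric (pfister bs) (pfister (b # cs))"
    unfolding pfister_forms_def mem_Collect_eq by (metis pfister_single_tensor)
  have "two_independent (a # cs)"
    using anisotropic_isometric[OF iso(1)] assms(3) anisotropic_pfister_iff by blast
  moreover have "sq_adjoin as = sq_adjoin (a # cs)" "sq_adjoin bs = sq_adjoin (b # cs)"
    using iso[THEN form_values_isometric] form_values_pfister by blast+
  ultimately show ?thesis
    using that[of cs] cs sq_adjoin_Cons_subset by (metis le_inf_iff two_independent.simps(2))
qed

end

theorem theorem4p3:
  fixes n :: nat
  assumes "CHAR('a::field) = 2"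
    and "n \<ge> 2"
    and "finite_over_squares TYPE('a)"
    and "rank2 TYPE('a) \<ge> n + 1"
  shows "\<not> I_linked TYPE('a) n"
proof
  assume linked: "I_linked TYPE('a) n"
  obtain es :: "'a list" where es: "two_independent es" "length es = rank2 TYPE('a)"
    using exists_two_basis[OF assms(1,3)] .
  \<comment> \<open>Only n + 1 of the elements are kept; a tail is taken because 2-independence
    passes to tails.\<close>
  define fs where "fs = drop (length es - (n + 1)) es"
  have fs: "two_independent fs" "length fs = n + 1"
    using two_independent_drop[OF es(1)] es(2) assms(4) unfolding fs_def by simp_all
  \<comment> \<open>\<open>m = n - 2\<close> is the number of generators left in \<open>ds\<close>
    once \<open>c\<close>, \<open>a\<close> and \<open>b\<close> are split off.\<close>
  obtain m where m: "n = 2 + m" using assms(2) le_Suc_ex by blast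
  obtain c xs where xs: "fs = c # xs" "length xs = n" using fs(2) by (cases fs) simp_all
  obtain a ys where ys: "xs = a # ys" "length ys = m + 1" using xs(2) m by (cases xs) simp_all
  obtain b ds where ds': "ys = b # ds" and ds: "length ds = m" using ys(2) by (cases ys) simp_all
  have fs_eq: "fs = c # a # b # ds" using xs ys ds' by simp
  let ?as = "a # b # ds" and ?bs = "(a + b * c) # c # ds"
  have ind: "two_independent ?as" "two_independent ds"
    using fs(1) unfolding fs_eq two_independent.simps by blast+
  have ind': "two_independent ?bs"
    using fs(1) two_independent_transform[OF assms(1)] unfolding fs_eq by blast
  have len: "n \<ge> 1" "length ?as = n" "length ?bs = n" using ds m by simp_all
  obtain cs where cs: "two_independent cs" "length cs = n - 1"
    "sq_adjoin cs \<subseteq> sq_adjoin ?as \<inter> sq_adjoin ?bs"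
    by (rule linked_common_subfield[OF assms(1) linked len(1) ind(1) ind' len(2,3)])
  have "sq_adjoin cs \<subseteq> sq_adjoin ds"
    using cs(3) sq_adjoin_inter[OF assms(1)] fs(1) unfolding fs_eq by blast
  \<comment> \<open>The common subfield has n - 1 independent generators, but it would have to fit
    into a field with only n - 2.\<close>
  hence "length cs \<le> length ds"
    using two_independent_length_le[OF assms(1) cs(1) ind(2)] by simp
  thus False using cs(2) ds m by simp
qed

end
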